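(* Let $G$ be a connected graph on $n$ vertices with $\delta(G)\ge 3$. Then $G$ contains a $1$-removable $\min\{\lfloor n/2\rfloor,\,\delta(G)\}$-matching.
   Context: All graphs are finite, undirected and simple. $\delta(G)$ is the minimum degree of $G$. For $F\subseteq E(G)$, $G-F$ is the graph with vertex set $V(G)$ and edge set $E(G)\setminus F$. A matching is a set of pairwise vertex-disjoint edges; an $\ell$-matching is a matching with exactly $\ell$ edges. A matching $M$ in a connected graph $G$ is $1$-removable if $G-M$ is still connected. *)

theory Defs
  imports Main
begin

text \<open>
  A graph is given by its vertex set \<open>V\<close> and its edge set \<open>E\<close>, an undirected edge being a
  two-element set of vertices. For \<open>F \<subseteq> E\<close> the graph \<open>G - F\<close> is then the pair of
  \<open>V\<close> and \<open>E - F\<close>.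
\<close>

locale simple_graph =
  fixes V :: "'a set" and E :: "'a set set"
  assumes finite_verts: "finite V"
    and edge_subset: "e \<in> E \<Longrightarrow> e \<subseteq> V"
    and edge_card: "e \<in> E \<Longrightarrow> card e = 2"

definition adjacent :: "'a set set \<Rightarrow> 'a \<Rightarrow> 'a \<Rightarrow> bool" where
  "adjacent E u v \<longleftrightarrow> {u, v} \<in> E"

definition degree :: "'a set set \<Rightarrow> 'a \<Rightarrow> nat" where
  "degree E v = card {e \<in> E. v \<in> e}"

text \<open>Unspecified for the graph without vertices, which is not connected in the sense below.\<close>

definition min_degree :: "'a set \<Rightarrow> 'a set set \<Rightarrow> nat" where
  "min_degree V E = Min (degree E ` V)"

definition connected_graph :: "'a set \<Rightarrow> 'a set set \<Rightarrow> bool" where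
  "connected_graph V E \<longleftrightarrow> V \<noteq> {} \<and> (\<forall>u\<in>V. \<forall>v\<in>V. (adjacent E)\<^sup>*\<^sup>* u v)"

definition matching :: "'a set set \<Rightarrow> 'a set set \<Rightarrow> bool" where
  "matching E M \<longleftrightarrow> M \<subseteq> E \<and> pairwise disjnt M"

definition l_matching :: "nat \<Rightarrow> 'a set set \<Rightarrow> 'a set set \<Rightarrow> bool" where
  "l_matching l E M \<longleftrightarrow> matching E M \<and> finite M \<and> card M = l"

definition one_removable :: "'a set \<Rightarrow> 'a set set \<Rightarrow> 'a set set \<Rightarrow> bool" where
  "one_removable V E M \<longleftrightarrow> connected_graph V (E - M)"

end

theory Submission
  imports Defs
begin

text \<open>
  A removable matching with fewer edges than both \<open>\<lfloor>n/2\<rfloor>\<close> and \<open>\<delta>(G)\<close> can always be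
  replaced by a removable matching with one edge more; starting from the empty matching, this gives
  the theorem. Suppose that some such matching \<open>M\<close> could not be enlarged, write \<open>d\<close> for the
  minimum degree and \<open>H = G - M\<close>, and call a vertex free if \<open>M\<close> does not cover it. There are at
  least two free vertices, and at most \<open>2(d - 1)\<close> covered ones.

  Adding to \<open>M\<close> an edge between free vertices must disconnect \<open>H\<close>, so every such edge is a bridge
  of \<open>H\<close>. If two free vertices lie on no bridge, they send at least \<open>2d\<close> edges to the at most
  \<open>d - 1\<close> edges of \<open>M\<close>; some \<open>xy\<close> in \<open>M\<close> receives three of them, and exchanging \<open>xy\<close>
  for two of these enlarges \<open>M\<close>. Hence at most one free vertex lies on no bridge
  (\<open>bridgeless_free_unique\<close>); in particular \<open>H\<close> has a bridge.

  Consider the leaves of the tree of bridgeless components of \<open>H\<close>, called lobes here. Such a leaf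
  \<open>L\<close> is joined to the rest by one edge at one vertex \<open>a\<close>, and no other vertex of \<open>L\<close> lies on
  a bridge. So \<open>L - a\<close> contains at most one free vertex, and because covered vertices keep degree
  at least \<open>d - 1\<close> and free ones degree at least \<open>d\<close>, it contains at least \<open>d - 1\<close> covered
  vertices (\<open>lobe_covered\<close>). Three lobes would need more than the \<open>2(d - 1)\<close> covered vertices
  available, so there are exactly two, and for them all estimates are equalities: their attachment
  vertices are free, the other vertices of each lobe form a clique together with the attachment
  vertex, and \<open>M\<close> consists of \<open>d - 1\<close> edges between the two lobes. A free vertex outside the
  lobes would meet three bridges and hence create a third lobe; so the two attachment vertices
  \<open>a\<close>, \<open>a'\<close> are adjacent. Now replace two edges \<open>x\<^sub>1y\<^sub>1\<close>, \<open>x\<^sub>2y\<^sub>2\<close> of \<open>M\<close> by the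
  three edges \<open>x\<^sub>1x\<^sub>2\<close>, \<open>y\<^sub>1y\<^sub>2\<close>, \<open>aa'\<close>. The result is a larger matching, and it is
  removable, since the removed edges are bypassed by the paths \<open>x\<^sub>1ax\<^sub>2\<close>, \<open>y\<^sub>1a'y\<^sub>2\<close> and
  \<open>ax\<^sub>1y\<^sub>1a'\<close> (\<open>no_two_complete_lobes\<close>).
\<close>

section \<open>Neighbourhoods, cuts and bridges\<close>

definition neighbours :: "'a set set \<Rightarrow> 'a \<Rightarrow> 'a set" where
  "neighbours F v = {w. {v, w} \<in> F}"

definition edge_cut :: "'a set set \<Rightarrow> 'a set \<Rightarrow> 'a set set" where
  "edge_cut F X = {e \<in> F. e \<inter> X \<noteq> {} \<and> \<not> e \<subseteq> X}"

text \<open>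
  In a connected graph these are the edges whose removal disconnects it. Naming a side of the
  bridge, rather than speaking of connectedness, makes the bridge structure accessible to
  uncrossing arguments: an edge that leaves an intersection of two sides leaves one of the sides.
\<close>

definition bridge :: "'a set \<Rightarrow> 'a set set \<Rightarrow> 'a set \<Rightarrow> bool" where
  "bridge V F e \<longleftrightarrow> (\<exists>X\<subseteq>V. edge_cut F X = {e})"

lemma connected_cut_nonempty:
  assumes "connected_graph V F" "X \<subseteq> V" "X \<noteq> {}" "X \<noteq> V"
  shows "edge_cut F X \<noteq> {}"
proof
  assume empty: "edge_cut F X = {}"
  obtain u w where u: "u \<in> X" and w: "w \<in> V" "w \<notin> X" using assms by blast
  have "(adjacent F)\<^sup>*\<^sup>* u w"
    using assms u w unfolding connected_graph_def by blast
  then have "w \<in> X"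
  proof induction
    case base
    show ?case by (rule u)
  next
    case (step y z)
    have "{y, z} \<in> F" using step.hyps(2) by (simp add: adjacent_def)
    with empty have "{y, z} \<inter> X = {} \<or> {y, z} \<subseteq> X" unfolding edge_cut_def by blast
    then show ?case using step.IH by blast
  qed
  with w show False by simp
qed

text \<open>
  All exchanges below are shown to preserve connectedness in this way: each edge that is given up
  is bypassed by a path of edges that stay.
\<close>

lemma connected_mono_paths:
  assumes "connected_graph V F"
    and "\<And>x y. {x, y} \<in> F \<Longrightarrow> (adjacent F')\<^sup>*\<^sup>* x y"
  shows "connected_graph V F'"
proof -
  have "(adjacent F')\<^sup>*\<^sup>* u v" if "(adjacent F)\<^sup>*\<^sup>* u v" for u v
    using that
  proof induction
    case (step y z)
    then have "(adjacent F')\<^sup>*\<^sup>* y z" using assms(2) by (simp add: adjacent_def)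
    with step.IH show ?case by (rule rtranclp_trans)
  qed simp
  then show ?thesis using assms(1) unfolding connected_graph_def by blast
qed

lemma adjacent_sym_paths:
  assumes "(adjacent F)\<^sup>*\<^sup>* x y"
  shows "(adjacent F)\<^sup>*\<^sup>* y x"
proof -
  have "symp (adjacent F)" by (auto simp: symp_def adjacent_def insert_commute)
  then show ?thesis using assms by (metis symp_rtranclp sympD)
qed

context simple_graph
begin

lemma finite_edges: "finite E"
  by (rule finite_subset[of _ "Pow V"]) (use edge_subset finite_verts in auto)

lemma edge_verts: "{x, y} \<in> E \<Longrightarrow> x \<in> V \<and> y \<in> V \<and> x \<noteq> y"
  using edge_subset[of "{x, y}"] edge_card[of "{x, y}"] by auto

lemma edge_obtain:
  assumes "e \<in> E"
  obtains x y where "e = {x, y}" "x \<noteq> y"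
  using edge_card[OF assms] by (auto simp: card_2_iff)

lemma neighbours_subset: "neighbours E v \<subseteq> V - {v}"
  using edge_verts by (auto simp: neighbours_def)

lemma card_neighbours: "card (neighbours E v) = degree E v"
proof -
  have "bij_betw (\<lambda>w. {v, w}) (neighbours E v) {e \<in> E. v \<in> e}"
  proof (rule bij_betw_imageI)
    show "inj_on (\<lambda>w. {v, w}) (neighbours E v)"
      by (auto simp: inj_on_def doubleton_eq_iff)
    show "(\<lambda>w. {v, w}) ` neighbours E v = {e \<in> E. v \<in> e}"
    proof (intro equalityI subsetI)
      fix e assume "e \<in> {e \<in> E. v \<in> e}"
      then have e: "e \<in> E" "v \<in> e" by auto
      obtain x y where "e = {x, y}" using edge_obtain[OF e(1)] by blast
      with e have "e = {v, x} \<or> e = {v, y}" by auto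
      with e show "e \<in> (\<lambda>w. {v, w}) ` neighbours E v" by (auto simp: neighbours_def)
    qed (auto simp: neighbours_def)
  qed
  then show ?thesis unfolding degree_def by (rule bij_betw_same_card)
qed

lemma cut_complement:
  assumes "F \<subseteq> E" "X \<subseteq> V"
  shows "edge_cut F (V - X) = edge_cut F X"
  using assms edge_subset unfolding edge_cut_def by blast

lemma bridge_side_avoiding:
  assumes "F \<subseteq> E" "bridge V F e"
  obtains X where "X \<subseteq> V" "b \<notin> X" "edge_cut F X = {e}"
  using assms cut_complement unfolding bridge_def by (metis DiffE Diff_subset)

text \<open>
  If \<open>F - e\<close> is disconnected, no edge of \<open>F - e\<close> leaves the set of vertices that can be reached
  from a suitable vertex; but some edge of \<open>F\<close> does, and this can only be \<open>e\<close>.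
\<close>

lemma connected_remove_non_bridge:
  assumes F: "F \<subseteq> E" and con: "connected_graph V F" and nb: "\<not> bridge V F e"
  shows "connected_graph V (F - {e})"
proof (rule ccontr)
  assume "\<not> ?thesis"
  then obtain u v where uv: "u \<in> V" "v \<in> V" "\<not> (adjacent (F - {e}))\<^sup>*\<^sup>* u v"
    using con unfolding connected_graph_def by blast
  define X where "X = {w \<in> V. (adjacent (F - {e}))\<^sup>*\<^sup>* u w}"
  have X: "X \<subseteq> V" "u \<in> X" "v \<notin> X" using uv by (auto simp: X_def)
  have "f = e" if f: "f \<in> edge_cut F X" for f
  proof (rule ccontr)
    assume "f \<noteq> e"
    from f have fF: "f \<in> F" by (simp add: edge_cut_def)
    with F obtain x y where xy: "f = {x, y}" using edge_obtain by blast
    have adj: "adjacent (F - {e}) x y" "adjacent (F - {e}) y x"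
      using fF \<open>f \<noteq> e\<close> by (auto simp: xy adjacent_def insert_commute)
    have "x \<in> V" "y \<in> V" using F fF xy edge_verts by blast+
    then have "x \<in> X \<longleftrightarrow> y \<in> X"
      using adj unfolding X_def by (auto intro: rtranclp.rtrancl_into_rtrancl)
    then show False using f xy unfolding edge_cut_def by auto
  qed
  moreover have "edge_cut F X \<noteq> {}"
    using connected_cut_nonempty[OF con X(1)] X uv by blast
  ultimately have "edge_cut F X = {e}" by blast
  with X(1) nb show False unfolding bridge_def by blast
qed

end

section \<open>Matchings that cannot be enlarged\<close>

text \<open>
  The hypothetical counterexample to the enlargement step. The assumptions turn out to be
  contradictory; every lemma in this locale is a step towards that.
\<close>

locale stuck_matching = simple_graph V E for V :: "'a set" and E :: "'a set set" +
  fixes M :: "'a set set" and d :: nat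
  assumes matching: "matching E M"
    and connected: "connected_graph V (E - M)"
    and stuck: "\<lbrakk>matching E M'; card M' = Suc (card M)\<rbrakk> \<Longrightarrow> \<not> connected_graph V (E - M')"
    and degree_ge: "v \<in> V \<Longrightarrow> d \<le> degree E v"
    and d_ge: "3 \<le> d"
    and few_edges: "card M < d"
    and few_covered: "2 * card M + 2 \<le> card V"
begin

abbreviation H :: "'a set set" where "H \<equiv> E - M"

abbreviation is_bridge :: "'a set \<Rightarrow> bool" where "is_bridge \<equiv> bridge V H"

definition free :: "'a set" where "free = V - \<Union>M"

lemma M_subset: "M \<subseteq> E" and M_disjnt: "pairwise disjnt M"
  using matching by (auto simp: matching_def)

lemma finite_M: "finite M"
  using M_subset finite_edges by (rule finite_subset)

lemma covered_subset: "\<Union>M \<subseteq> V"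
  using M_subset edge_subset by blast

lemma finite_covered: "finite (\<Union>M)"
  using covered_subset finite_verts by (rule finite_subset)

lemma M_edges_meet: "\<lbrakk>m \<in> M; m' \<in> M; x \<in> m; x \<in> m'\<rbrakk> \<Longrightarrow> m = m'"
  using M_disjnt unfolding pairwise_def disjnt_def by blast

lemma card_covered: "card (\<Union>M) = 2 * card M"
proof -
  have "card (\<Union>M) = sum card M"
  proof (rule card_Union_disjoint[OF M_disjnt])
    fix m assume "m \<in> M"
    then show "finite m" using M_subset edge_subset finite_verts by (meson finite_subset subsetD)
  qed
  also have "\<dots> = (\<Sum>m\<in>M. 2)"
    using M_subset edge_card by (intro sum.cong) auto
  finally show ?thesis by simp
qed

lemma H_neighbours_free:
  assumes "v \<in> free"
  shows "neighbours H v = neighbours E v"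
  using assms by (auto simp: neighbours_def free_def)

lemma finite_neighbours: "finite (neighbours H v)"
  by (rule finite_subset[of _ V]) (use neighbours_subset finite_verts in \<open>auto simp: neighbours_def\<close>)

lemma H_degree_free:
  assumes "v \<in> free"
  shows "d \<le> card (neighbours H v)"
  using assms degree_ge card_neighbours H_neighbours_free by (simp add: free_def)

lemma H_degree:
  assumes "v \<in> V"
  shows "d - 1 \<le> card (neighbours H v)"
proof (cases "v \<in> free")
  case True
  then show ?thesis using H_degree_free[of v] by simp
next
  case False
  then obtain m where m: "m \<in> M" "v \<in> m" using assms by (auto simp: free_def)
  obtain x y where "m = {x, y}" using m M_subset edge_obtain by blast
  with m obtain w where w: "m = {v, w}" by (auto simp: insert_commute)
  have "neighbours E v - {w} \<subseteq> neighbours H v"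
  proof
    fix z assume z: "z \<in> neighbours E v - {w}"
    have "{v, z} \<notin> M"
    proof
      assume "{v, z} \<in> M"
      then have "{v, z} = m" using m M_edges_meet by blast
      with z w show False by (auto simp: doubleton_eq_iff)
    qed
    with z show "z \<in> neighbours H v" by (auto simp: neighbours_def)
  qed
  then have "card (neighbours E v - {w}) \<le> card (neighbours H v)"
    by (rule card_mono[OF finite_neighbours])
  moreover have "card (neighbours E v) - 1 \<le> card (neighbours E v - {w})"
    by (simp add: card_Diff_singleton_if)
  moreover have "d \<le> card (neighbours E v)"
    using degree_ge[OF assms] by (simp add: card_neighbours)
  ultimately show ?thesis by linarith
qed

lemma free_edge_bridge:
  assumes uv: "{u, v} \<in> E" and free: "u \<in> free" "v \<in> free"
  shows "is_bridge {u, v}"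
proof (rule ccontr)
  assume nb: "\<not> is_bridge {u, v}"
  have new: "{u, v} \<notin> M" using free by (auto simp: free_def)
  have "E - insert {u, v} M = H - {{u, v}}" by blast
  then have "connected_graph V (E - insert {u, v} M)"
    using connected_remove_non_bridge[OF _ connected nb] by simp
  moreover have "matching E (insert {u, v} M)"
    using uv M_subset M_disjnt free
    by (auto simp: matching_def pairwise_insert disjnt_def free_def)
  moreover have "card (insert {u, v} M) = Suc (card M)" using new finite_M by simp
  ultimately show False using stuck by blast
qed

text \<open>
  Exchanging \<open>xy\<close> for \<open>uy\<close> and \<open>vx\<close> enlarges \<open>M\<close>. The edge \<open>uy\<close> can be given up because
  of the triangle \<open>uxy\<close>, whose edge \<open>xy\<close> has just become available. So only \<open>vx\<close> can stand in
  the way.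
\<close>

lemma triangle_exchange_bridge:
  assumes uv: "u \<in> free" "v \<in> free" "u \<noteq> v" and xy: "{x, y} \<in> M"
    and ux: "{u, x} \<in> E" and uy: "{u, y} \<in> E" and vx: "{v, x} \<in> E"
  shows "is_bridge {v, x}"
proof (rule ccontr)
  assume nb: "\<not> is_bridge {v, x}"
  let ?M = "insert {u, y} (insert {v, x} (M - {{x, y}}))"
  have xyE: "{x, y} \<in> E" using xy M_subset by blast
  have ne: "x \<noteq> y" "u \<noteq> x" "u \<noteq> y" "v \<noteq> x" "v \<noteq> y"
    using edge_verts[OF xyE] xy uv by (auto simp: free_def)
  have out: "x \<notin> m \<and> y \<notin> m \<and> u \<notin> m \<and> v \<notin> m" if "m \<in> M - {{x, y}}" for m
    using that uv M_edges_meet[OF _ xy] by (auto simp: free_def)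
  have "matching E ?M"
    using out M_subset M_disjnt uy vx ne uv(3)
    by (auto simp: matching_def pairwise_insert disjnt_def pairwise_def)
  moreover have "card ?M = Suc (card M)"
  proof -
    have "{v, x} \<notin> M - {{x, y}}" "{u, y} \<notin> insert {v, x} (M - {{x, y}})"
      using out ne uv(3) by (auto simp: doubleton_eq_iff)
    then have "card ?M = Suc (Suc (card (M - {{x, y}})))"
      using finite_M by simp
    then show ?thesis using card_Suc_Diff1[OF finite_M xy] by simp
  qed
  moreover have "connected_graph V (E - ?M)"
  proof (rule connected_mono_paths)
    show "connected_graph V (H - {{v, x}})"
      by (rule connected_remove_non_bridge[OF _ connected nb]) auto
    fix p q assume pq: "{p, q} \<in> H - {{v, x}}"
    have "{u, x} \<notin> M" using uv by (auto simp: free_def)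
    then have "adjacent (E - ?M) u x" "adjacent (E - ?M) x y"
      using ux xyE ne uv(3) by (auto simp: adjacent_def doubleton_eq_iff)
    then have path: "(adjacent (E - ?M))\<^sup>*\<^sup>* u y"
      by (meson converse_rtranclp_into_rtranclp r_into_rtranclp)
    show "(adjacent (E - ?M))\<^sup>*\<^sup>* p q"
    proof (cases "{p, q} = {u, y}")
      case True
      then show ?thesis using path adjacent_sym_paths[OF path] by (auto simp: doubleton_eq_iff)
    next
      case False
      then have "adjacent (E - ?M) p q" using pq by (auto simp: adjacent_def)
      then show ?thesis by (rule r_into_rtranclp)
    qed
  qed
  ultimately show False using stuck by blast
qed

text \<open>
  Neither vertex has a free neighbour, so each sends all of its at least \<open>d\<close> edges to \<open>M\<close>. As
  \<open>M\<close> has fewer than \<open>d\<close> edges, one of them receives three of these edges, which is the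
  situation of the triangle exchange.
\<close>

lemma bridgeless_free_unique:
  assumes u: "u \<in> free" "\<And>e. is_bridge e \<Longrightarrow> u \<notin> e"
    and v: "v \<in> free" "\<And>e. is_bridge e \<Longrightarrow> v \<notin> e"
  shows "u = v"
proof (rule ccontr)
  assume "u \<noteq> v"
  have sum_ge: "d \<le> (\<Sum>m\<in>M. card (m \<inter> neighbours E w))"
    if w: "w \<in> free" "\<And>e. is_bridge e \<Longrightarrow> w \<notin> e" for w
  proof -
    have "neighbours E w \<subseteq> \<Union>M"
    proof
      fix z assume z: "z \<in> neighbours E w"
      then have zE: "{w, z} \<in> E" by (simp add: neighbours_def)
      show "z \<in> \<Union>M"
      proof (rule ccontr)
        assume "z \<notin> \<Union>M"
        then have "z \<in> free" using zE edge_verts by (auto simp: free_def)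
        from free_edge_bridge[OF zE w(1) this] w(2) show False by blast
      qed
    qed
    then have "neighbours E w = (\<Union>m\<in>M. m \<inter> neighbours E w)" by blast
    then have "card (neighbours E w) = card (\<Union>m\<in>M. m \<inter> neighbours E w)" by simp
    also have "\<dots> \<le> (\<Sum>m\<in>M. card (m \<inter> neighbours E w))"
      by (rule card_UN_le[OF finite_M])
    finally show ?thesis
      using degree_ge[of w] w(1) card_neighbours[of w] by (simp add: free_def)
  qed
  have "\<exists>m\<in>M. 2 < card (m \<inter> neighbours E u) + card (m \<inter> neighbours E v)"
  proof (rule ccontr)
    assume "\<not> ?thesis"
    then have "(\<Sum>m\<in>M. card (m \<inter> neighbours E u) + card (m \<inter> neighbours E v)) \<le> (\<Sum>m\<in>M. 2)"
      by (intro sum_mono) (auto simp: not_less)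
    then show False using sum_ge[OF u] sum_ge[OF v] few_edges by (simp add: sum.distrib)
  qed
  then obtain m where m: "m \<in> M" "2 < card (m \<inter> neighbours E u) + card (m \<inter> neighbours E v)"
    by blast
  obtain x y where xy: "m = {x, y}" "x \<noteq> y" using m(1) M_subset edge_obtain by blast
  have cards: "card ({x, y} \<inter> N) = (if x \<in> N then 1 else 0) + (if y \<in> N then 1 else 0)" for N
    using xy(2) by (cases "x \<in> N"; cases "y \<in> N") auto
  have "{x, y} \<in> M" "{y, x} \<in> M" using m(1) xy(1) by (auto simp: insert_commute)
  moreover have "({u, x} \<in> E \<and> {u, y} \<in> E \<and> ({v, x} \<in> E \<or> {v, y} \<in> E)) \<or>
      ({v, x} \<in> E \<and> {v, y} \<in> E \<and> ({u, x} \<in> E \<or> {u, y} \<in> E))"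
    using m(2) unfolding xy(1) cards neighbours_def by (auto split: if_splits)
  ultimately have "is_bridge {v, x} \<or> is_bridge {v, y} \<or> is_bridge {u, x} \<or> is_bridge {u, y}"
    using triangle_exchange_bridge u(1) v(1) \<open>u \<noteq> v\<close> by metis
  then show False using u(2) v(2) by blast
qed

section \<open>Lobes\<close>

text \<open>
  The leaves of the tree that arises from \<open>H\<close> by contracting its bridgeless components: \<open>ab\<close> is
  the only edge that leaves \<open>L\<close>, and no bridge runs inside \<open>L\<close>.
\<close>

definition lobe :: "'a set \<Rightarrow> 'a \<Rightarrow> 'a \<Rightarrow> bool" where
  "lobe L a b \<longleftrightarrow> L \<subseteq> V \<and> a \<in> L \<and> b \<notin> L \<and> edge_cut H L = {{a, b}} \<and>
     (\<forall>e. is_bridge e \<longrightarrow> e \<inter> (L - {a}) = {})"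

lemma cut_edge_ends:
  assumes "edge_cut H X = {e}"
  obtains a b where "e = {a, b}" "a \<in> X" "b \<notin> X"
proof -
  have e: "e \<in> E" "e \<inter> X \<noteq> {}" "\<not> e \<subseteq> X" using assms by (auto simp: edge_cut_def)
  obtain p q where "e = {p, q}" using edge_obtain[OF e(1)] by blast
  with e that show ?thesis by (auto simp: insert_commute)
qed

text \<open>
  Among the subsets of \<open>X\<close> that only one edge leaves, take a smallest one. A bridge inside it would
  have a side \<open>Y\<close> that does not contain the attachment edge, and the bridge would then be the only
  edge to leave the smaller set \<open>Y \<inter> L\<close>.
\<close>

lemma lobe_exists:
  assumes X: "X \<subseteq> V" "edge_cut H X = {e}"
  obtains L a b where "lobe L a b" "L \<subseteq> X"
proof -
  define P where "P L \<longleftrightarrow> L \<subseteq> X \<and> (\<exists>f. edge_cut H L = {f})" for L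
  have "P X" using X by (auto simp: P_def)
  then obtain L where L: "P L" and least: "\<And>L'. P L' \<Longrightarrow> card L \<le> card L'"
    using ex_has_least_nat[of P X card] by blast
  then obtain f where f: "edge_cut H L = {f}" and LX: "L \<subseteq> X" by (auto simp: P_def)
  have finL: "finite L" using LX X finite_verts by (meson finite_subset)
  obtain a b where ab: "f = {a, b}" "a \<in> L" "b \<notin> L" using cut_edge_ends[OF f] by blast
  have "g \<inter> (L - {a}) = {}" if g: "is_bridge g" for g
  proof (rule ccontr)
    assume meets: "g \<inter> (L - {a}) \<noteq> {}"
    obtain Y where Y: "b \<notin> Y" "edge_cut H Y = {g}"
      by (rule bridge_side_avoiding[OF Diff_subset g])
    have gH: "g \<in> H" using Y(2) by (auto simp: edge_cut_def)
    have gL: "g \<subseteq> L"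
    proof (rule ccontr)
      assume "\<not> g \<subseteq> L"
      then have "g \<in> edge_cut H L" using gH meets by (auto simp: edge_cut_def)
      then have "g = {a, b}" using f ab by simp
      with meets ab show False by auto
    qed
    have abH: "{a, b} \<in> H" using f ab by (auto simp: edge_cut_def)
    have "a \<notin> Y"
    proof
      assume "a \<in> Y"
      then have "{a, b} \<in> edge_cut H Y" using abH Y(1) by (auto simp: edge_cut_def)
      then have "{a, b} = g" using Y(2) by simp
      with gL ab show False by auto
    qed
    have "edge_cut H (Y \<inter> L) = {g}"
    proof (intro equalityI subsetI)
      fix h assume "h \<in> edge_cut H (Y \<inter> L)"
      then have "h \<in> edge_cut H Y \<union> edge_cut H L" and h: "h \<inter> Y \<noteq> {}"
        unfolding edge_cut_def by blast+
      then have "h = g \<or> h = {a, b}" unfolding Y(2) f ab(1) by blast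
      with h show "h \<in> {g}" using \<open>a \<notin> Y\<close> Y(1) by auto
    next
      fix h assume "h \<in> {g}"
      then have "h = g" by simp
      moreover have "g \<in> edge_cut H Y" using Y(2) by simp
      ultimately show "h \<in> edge_cut H (Y \<inter> L)" using gL by (auto simp: edge_cut_def)
    qed
    then have "P (Y \<inter> L)" using LX by (auto simp: P_def)
    then have "card L \<le> card (Y \<inter> L)" by (rule least)
    moreover have "Y \<inter> L \<subset> L" using ab(2) \<open>a \<notin> Y\<close> by blast
    then have "card (Y \<inter> L) < card L" by (rule psubset_card_mono[OF finL])
    ultimately show False by simp
  qed
  then have "lobe L a b" using LX X(1) f ab by (auto simp: lobe_def)
  then show thesis using that LX by blast
qed

lemma lobe_neighbours:
  assumes "lobe L a b" "x \<in> L - {a}"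
  shows "neighbours H x \<subseteq> L - {x}"
proof
  fix z assume "z \<in> neighbours H x"
  then have z: "{x, z} \<in> H" by (simp add: neighbours_def)
  have "z \<in> L"
  proof (rule ccontr)
    assume "z \<notin> L"
    then have "{x, z} \<in> edge_cut H L" using z assms by (auto simp: edge_cut_def)
    then have "{x, z} = {a, b}" using assms by (simp add: lobe_def)
    then show False using assms by (auto simp: lobe_def doubleton_eq_iff)
  qed
  then show "z \<in> L - {x}" using z edge_verts by auto
qed

lemma finite_lobe: "lobe L a b \<Longrightarrow> finite L"
  by (rule finite_subset[OF _ finite_verts]) (simp add: lobe_def)

lemma lobe_free_unique:
  assumes L: "lobe L a b" and u: "u \<in> L - {a}" "u \<in> free" and w: "w \<in> L - {a}" "w \<in> free"
  shows "u = w"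
  by (rule bridgeless_free_unique) (use assms in \<open>auto simp: lobe_def\<close>)

text \<open>
  All neighbours in \<open>H\<close> of a vertex of \<open>L - a\<close> lie in \<open>L\<close>. A covered vertex therefore forces
  \<open>L - a\<close> to have \<open>d - 1\<close> elements, and a free one forces \<open>d\<close>, of which it is the only free one.
\<close>

lemma lobe_covered:
  assumes L: "lobe L a b"
  shows "d - 1 \<le> card ((L - {a}) \<inter> \<Union>M)"
proof -
  note fin = finite_lobe[OF L]
  have aL: "a \<in> L" and LV: "L \<subseteq> V" using L by (auto simp: lobe_def)
  have deg: "card (neighbours H x) \<le> card (L - {a})" if "x \<in> L - {a}" for x
    using card_mono[OF _ lobe_neighbours[OF L that]] fin that aL by (simp add: card_Diff_singleton)
  show ?thesis
  proof (cases "L - {a} \<subseteq> \<Union>M")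
    case True
    \<comment> \<open>The attachment vertex has at least two neighbours in \<open>H\<close>, so \<open>L - {a}\<close> is not empty.\<close>
    have "neighbours H a \<noteq> {b} \<and> neighbours H a \<noteq> {}"
      using H_degree[of a] aL LV d_ge by auto
    then obtain x where x: "x \<in> neighbours H a" "x \<noteq> b" by blast
    then have ax: "{a, x} \<in> H" by (simp add: neighbours_def)
    have "x \<in> L"
    proof (rule ccontr)
      assume "x \<notin> L"
      then have "{a, x} \<in> edge_cut H L" using ax aL by (auto simp: edge_cut_def)
      then have "{a, x} = {a, b}" using L by (simp add: lobe_def)
      with x(2) show False by (auto simp: doubleton_eq_iff)
    qed
    then have xL: "x \<in> L - {a}" using ax edge_verts by auto
    have "d - 1 \<le> card (L - {a})"
      using H_degree[of x] deg[OF xL] xL LV by fastforce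
    then show ?thesis using True by (simp add: Int_absorb2)
  next
    case False
    then obtain u where u: "u \<in> L - {a}" "u \<in> free" using LV by (auto simp: free_def)
    have "L - {a} - {u} \<subseteq> (L - {a}) \<inter> \<Union>M"
      using lobe_free_unique[OF L u] LV by (auto simp: free_def)
    then have "card (L - {a} - {u}) \<le> card ((L - {a}) \<inter> \<Union>M)"
      using fin by (intro card_mono) auto
    moreover have "d \<le> card (L - {a})" using H_degree_free[OF u(2)] deg[OF u(1)] by simp
    moreover have "card (L - {a} - {u}) = card (L - {a}) - 1"
      using fin u(1) by (simp add: card_Diff_singleton)
    ultimately show ?thesis by linarith
  qed
qed

text \<open>
  Each of the sets contains a lobe, so that there would be at least \<open>3(d - 1)\<close> covered vertices.
\<close>

lemma no_three_disjoint_sides: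
  assumes "X \<subseteq> V" "edge_cut H X = {e}" and "Y \<subseteq> V" "edge_cut H Y = {f}" and "Z \<subseteq> V" "edge_cut H Z = {g}"
    and disj: "X \<inter> Y = {}" "X \<inter> Z = {}" "Y \<inter> Z = {}"
  shows False
proof -
  obtain L a b where L: "lobe L a b" "L \<subseteq> X" using lobe_exists assms by metis
  obtain L' a' b' where L': "lobe L' a' b'" "L' \<subseteq> Y" using lobe_exists assms by metis
  obtain K c c' where K: "lobe K c c'" "K \<subseteq> Z" using lobe_exists assms by metis
  let ?A = "(L - {a}) \<inter> \<Union>M" and ?B = "(L' - {a'}) \<inter> \<Union>M" and ?C = "(K - {c}) \<inter> \<Union>M"
  have "card (?A \<union> ?B \<union> ?C) = card ?A + card ?B + card ?C"
  proof -
    have "?A \<inter> ?B = {}" "(?A \<union> ?B) \<inter> ?C = {}" using L(2) L'(2) K(2) disj by blast+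
    then show ?thesis using finite_covered by (simp add: card_Un_disjoint)
  qed
  moreover have "card (?A \<union> ?B \<union> ?C) \<le> card (\<Union>M)"
    by (rule card_mono[OF finite_covered]) auto
  ultimately show False
    using lobe_covered[OF L(1)] lobe_covered[OF L'(1)] lobe_covered[OF K(1)]
      card_covered few_edges d_ge by linarith
qed

text \<open>
  An edge that leaves \<open>X \<inter> Y\<close> is one of the two bridges; but neither of these ends in
  \<open>X \<inter> Y\<close>, as the far end of each lies on the side of that bridge only. So nothing leaves
  \<open>X \<inter> Y\<close>, which must be empty since \<open>H\<close> is connected.
\<close>

lemma bridge_sides_disjoint:
  assumes X: "X \<subseteq> V" "w \<notin> X" "edge_cut H X = {{w, p}}"
    and Y: "Y \<subseteq> V" "w \<notin> Y" "edge_cut H Y = {{w, q}}" and "p \<noteq> q"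
  shows "X \<inter> Y = {}"
proof (rule ccontr)
  assume ne: "X \<inter> Y \<noteq> {}"
  have e: "{w, p} \<in> H" "{w, q} \<in> H" using X Y by (auto simp: edge_cut_def)
  have wV: "w \<in> V" using e edge_verts by blast
  have "p \<notin> Y"
  proof
    assume "p \<in> Y"
    then have "{w, p} \<in> edge_cut H Y" using e Y(2) by (auto simp: edge_cut_def)
    with Y(3) \<open>p \<noteq> q\<close> show False by (auto simp: doubleton_eq_iff)
  qed
  have "q \<notin> X"
  proof
    assume "q \<in> X"
    then have "{w, q} \<in> edge_cut H X" using e X(2) by (auto simp: edge_cut_def)
    with X(3) \<open>p \<noteq> q\<close> show False by (auto simp: doubleton_eq_iff)
  qed
  have "edge_cut H (X \<inter> Y) = {}"
  proof (rule equals0I)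
    fix h assume h: "h \<in> edge_cut H (X \<inter> Y)"
    then have "h \<in> edge_cut H X \<or> h \<in> edge_cut H Y" by (auto simp: edge_cut_def)
    then have "h = {w, p} \<or> h = {w, q}" using X Y by auto
    then show False using h \<open>p \<notin> Y\<close> \<open>q \<notin> X\<close> X(2) by (auto simp: edge_cut_def)
  qed
  moreover have "X \<inter> Y \<noteq> V" using wV X(2) by blast
  ultimately show False using connected_cut_nonempty[OF connected, of "X \<inter> Y"] X(1) ne by blast
qed

lemma no_three_bridges_at_vertex:
  assumes "is_bridge {w, p}" "is_bridge {w, q}" "is_bridge {w, r}"
  shows "p = q \<or> p = r \<or> q = r"
proof (rule ccontr)
  assume ne: "\<not> ?thesis"
  obtain X where X: "X \<subseteq> V" "w \<notin> X" "edge_cut H X = {{w, p}}"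
    by (rule bridge_side_avoiding[OF Diff_subset assms(1)])
  obtain Y where Y: "Y \<subseteq> V" "w \<notin> Y" "edge_cut H Y = {{w, q}}"
    by (rule bridge_side_avoiding[OF Diff_subset assms(2)])
  obtain Z where Z: "Z \<subseteq> V" "w \<notin> Z" "edge_cut H Z = {{w, r}}"
    by (rule bridge_side_avoiding[OF Diff_subset assms(3)])
  show False
    using no_three_disjoint_sides[OF X(1,3) Y(1,3) Z(1,3)] bridge_sides_disjoint[OF X Y]
      bridge_sides_disjoint[OF X Z] bridge_sides_disjoint[OF Y Z] ne by blast
qed

section \<open>Two lobes\<close>

lemma bridge_exists: "\<exists>e. is_bridge e"
proof (rule ccontr)
  assume none: "\<not> ?thesis"
  have "card (V - \<Union>M) = card V - card (\<Union>M)"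
    by (rule card_Diff_subset[OF finite_covered covered_subset])
  then have two: "2 \<le> card free" using few_covered card_covered by (simp add: free_def)
  moreover have "\<forall>u\<in>free. \<forall>v\<in>free. u = v" using bridgeless_free_unique none by blast
  then have "card free \<le> Suc 0"
    using card_le_Suc0_iff_eq[of free] finite_verts by (simp add: free_def)
  ultimately show False by simp
qed

text \<open>
  If \<open>L - a\<close> had a free vertex \<open>u\<close>, then \<open>L\<close> would have exactly \<open>d + 1\<close> elements. Having
  degree at least \<open>d\<close> within \<open>L\<close>, \<open>u\<close> would be adjacent to all the others, also to \<open>a\<close>. But an edge between the free vertices \<open>u\<close>
  and \<open>a\<close> is a bridge, and no bridge runs inside a lobe. So \<open>L\<close> has \<open>d\<close> elements, and degree
  \<open>d - 1\<close> means adjacency to all the others.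
\<close>

lemma tight_lobe:
  assumes L: "lobe L a b" and a: "a \<in> free" and tight: "card ((L - {a}) \<inter> \<Union>M) = d - 1"
  shows "L - {a} \<subseteq> \<Union>M" and "\<And>x. x \<in> L - {a} \<Longrightarrow> neighbours H x = L - {x}"
proof -
  note fin = finite_lobe[OF L]
  have aL: "a \<in> L" and LV: "L \<subseteq> V" using L by (auto simp: lobe_def)
  show cov: "L - {a} \<subseteq> \<Union>M"
  proof (rule ccontr)
    assume "\<not> ?thesis"
    then obtain u where u: "u \<in> L - {a}" "u \<in> free" using LV by (auto simp: free_def)
    have "L - {a} - {u} \<subseteq> (L - {a}) \<inter> \<Union>M"
      using lobe_free_unique[OF L u] LV by (auto simp: free_def)
    moreover have "u \<notin> \<Union>M" using u by (simp add: free_def)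
    ultimately have "L - {u} = insert a ((L - {a}) \<inter> \<Union>M)"
      using aL u(1) by blast
    then have card_L: "card (L - {u}) = d" using fin tight d_ge by simp
    have "neighbours H u = L - {u}"
      by (rule card_seteq) (use fin lobe_neighbours[OF L u(1)] H_degree_free[OF u(2)] card_L in auto)
    then have "{u, a} \<in> E" using aL u(1) by (auto simp: neighbours_def)
    then have "is_bridge {u, a}" using free_edge_bridge u(2) a by blast
    then show False using L u(1) by (auto simp: lobe_def)
  qed
  fix x assume x: "x \<in> L - {a}"
  have "card (L - {x}) = d - 1"
    using cov tight x aL fin by (simp add: Int_absorb2 card_Diff_singleton)
  then show "neighbours H x = L - {x}"
    using fin lobe_neighbours[OF L x] H_degree[of x] x LV by (intro card_seteq) auto
qed

text \<open>
  The final exchange trades two edges for the three edges \<open>x\<^sub>1x\<^sub>2\<close>, \<open>y\<^sub>1y\<^sub>2\<close> and \<open>ab\<close>. These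
  are bypassed by \<open>x\<^sub>1ax\<^sub>2\<close>, \<open>y\<^sub>1by\<^sub>2\<close> and \<open>ax\<^sub>1y\<^sub>1b\<close>.
\<close>

lemma no_two_complete_lobes:
  assumes ne: "x1 \<noteq> x2" and M12: "{x1, y1} \<in> M" "{x2, y2} \<in> M"
    and ab: "a \<in> free" "b \<in> free" "{a, b} \<in> E"
    and x: "{x1, x2} \<in> H" "{a, x1} \<in> E" "{a, x2} \<in> E"
    and y: "{y1, y2} \<in> H" "{b, y1} \<in> E" "{b, y2} \<in> E"
  shows False
proof -
  let ?R = "M - {{x1, y1}, {x2, y2}}"
  let ?M = "insert {x1, x2} (insert {y1, y2} (insert {a, b} ?R))"
  have ney: "y1 \<noteq> y2" "a \<noteq> b" using y ab edge_verts by auto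
  have nxy: "x1 \<noteq> y1" "x2 \<noteq> y2" using M12 M_subset edge_verts by blast+
  have "{x1, y1} \<noteq> {x2, y2}"
  proof
    assume "{x1, y1} = {x2, y2}"
    then have "x1 = y2" "x2 = y1" using ne by (auto simp: doubleton_eq_iff)
    then show False using x(1) M12 by (auto simp: insert_commute)
  qed
  then have sep: "x1 \<noteq> y2" "x2 \<noteq> y1"
    using M_edges_meet[OF M12] by auto
  have nab: "a \<noteq> x1" "a \<noteq> x2" "a \<noteq> y1" "a \<noteq> y2" "b \<noteq> x1" "b \<noteq> x2" "b \<noteq> y1" "b \<noteq> y2"
    using ab M12 by (auto simp: free_def)
  note distinct = ne ney nxy sep nab
  have out: "x1 \<notin> m \<and> x2 \<notin> m \<and> y1 \<notin> m \<and> y2 \<notin> m \<and> a \<notin> m \<and> b \<notin> m" if "m \<in> ?R" for m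
    using that ab M_edges_meet[OF _ M12(1)] M_edges_meet[OF _ M12(2)] by (auto simp: free_def)
  have "matching E ?M"
    using out M_subset M_disjnt x(1) y(1) ab(3) distinct
    by (auto simp: matching_def pairwise_insert disjnt_def pairwise_def)
  moreover have "card ?M = Suc (card M)"
  proof -
    have "{a, b} \<notin> ?R" "{y1, y2} \<notin> insert {a, b} ?R" "{x1, x2} \<notin> insert {y1, y2} (insert {a, b} ?R)"
      using out x(1) y(1) distinct by (auto simp: doubleton_eq_iff)
    then have "card ?M = Suc (Suc (Suc (card ?R)))" using finite_M by simp
    moreover have "card ?R = card M - card {{x1, y1}, {x2, y2}}"
      using M12 by (intro card_Diff_subset) auto
    moreover have "card {{x1, y1}, {x2, y2}} = 2" using \<open>{x1, y1} \<noteq> {x2, y2}\<close> by simp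
    moreover have "card {{x1, y1}, {x2, y2}} \<le> card M" using M12 finite_M by (intro card_mono) auto
    ultimately show ?thesis by linarith
  qed
  moreover have "connected_graph V (E - ?M)"
  proof (rule connected_mono_paths[OF connected])
    fix p q assume pq: "{p, q} \<in> H"
    let ?A = "adjacent (E - ?M)"
    have notM: "{a, x1} \<notin> M" "{a, x2} \<notin> M" "{b, y1} \<notin> M" "{b, y2} \<notin> M"
      using ab by (auto simp: free_def)
    have A: "?A a x1" "?A a x2" "?A b y1" "?A b y2" "?A x1 y1"
      using x y notM M12 M_subset distinct by (auto simp: adjacent_def doubleton_eq_iff)
    then have B: "?A x1 a" "?A y1 b" by (auto simp: adjacent_def insert_commute)
    have paths: "?A\<^sup>*\<^sup>* x1 x2" "?A\<^sup>*\<^sup>* y1 y2" "?A\<^sup>*\<^sup>* a b"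
      using A B by (meson converse_rtranclp_into_rtranclp r_into_rtranclp)+
    show "?A\<^sup>*\<^sup>* p q"
    proof (cases "{p, q} \<in> {{x1, x2}, {y1, y2}, {a, b}}")
      case True
      then show ?thesis
        using paths adjacent_sym_paths[OF paths(1)] adjacent_sym_paths[OF paths(2)]
          adjacent_sym_paths[OF paths(3)] by (auto simp: doubleton_eq_iff)
    next
      case False
      then have "?A p q" using pq by (auto simp: adjacent_def)
      then show ?thesis by (rule r_into_rtranclp)
    qed
  qed
  ultimately show False using stuck by blast
qed

text \<open>
  The two sides of a bridge contain one lobe each. Together they account for all \<open>2(d - 1)\<close>
  covered vertices, which makes both lobes tight and puts them in the position of the final
  exchange.
\<close>

lemma stuck_impossible: False
proof -
  obtain X e where X: "X \<subseteq> V" "edge_cut H X = {e}" using bridge_exists by (auto simp: bridge_def)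
  obtain L a b where L: "lobe L a b" "L \<subseteq> X" using lobe_exists[OF X] by blast
  have "edge_cut H (V - X) = {e}" using cut_complement[of H X] X by simp
  then obtain L' a' b' where L': "lobe L' a' b'" "L' \<subseteq> V - X"
    using lobe_exists[of "V - X"] by blast
  have disj: "L \<inter> L' = {}" using L(2) L'(2) by blast
  have mem: "a \<in> L" "b \<notin> L" "L \<subseteq> V" "edge_cut H L = {{a, b}}"
    "a' \<in> L'" "b' \<notin> L'" "L' \<subseteq> V" "edge_cut H L' = {{a', b'}}"
    using L(1) L'(1) by (auto simp: lobe_def)
  let ?A = "(L - {a}) \<inter> \<Union>M" and ?B = "(L' - {a'}) \<inter> \<Union>M"
  have sum: "card (?A \<union> ?B) = card ?A + card ?B"
    using disj finite_covered by (intro card_Un_disjoint) auto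
  have "card (?A \<union> ?B) \<le> card (\<Union>M)"
    by (rule card_mono[OF finite_covered]) auto
  then have tight: "card ?A = d - 1" "card ?B = d - 1" "card (\<Union>M) = card (?A \<union> ?B)"
    using sum lobe_covered[OF L(1)] lobe_covered[OF L'(1)] card_covered few_edges by linarith+
  have "?A \<union> ?B = \<Union>M"
    by (rule card_seteq[OF finite_covered]) (use tight(3) in auto)
  then have M_in: "\<Union>M \<subseteq> (L - {a}) \<union> (L' - {a'})" by blast
  have a: "a \<in> free" and a': "a' \<in> free"
    using M_in mem disj by (auto simp: free_def)
  note tL = tight_lobe[OF L(1) a tight(1)] and tL' = tight_lobe[OF L'(1) a' tight(2)]
  have abH: "{a, b} \<in> H" using mem(4) by (auto simp: edge_cut_def)
  \<comment> \<open>If \<open>b\<close> lay outside \<open>L'\<close>, it would be free with only free neighbours in \<open>H\<close>, hence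
      the end of at least three bridges.\<close>
  have "b = a'"
  proof (cases "b \<in> L'")
    case True
    then have "{a, b} \<in> edge_cut H L'" using abH mem(1) disj by (auto simp: edge_cut_def)
    then have "{a, b} = {a', b'}" using mem(8) by simp
    then show ?thesis using mem(1,5) disj by (auto simp: doubleton_eq_iff)
  next
    case False
    have bV: "b \<in> V" using abH edge_verts by blast
    then have b: "b \<in> free" using False mem(2) M_in by (auto simp: free_def)
    have br: "is_bridge {b, z}" if z: "z \<in> neighbours H b" for z
    proof -
      have zH: "{b, z} \<in> H" "{z, b} \<in> H" using z by (auto simp: neighbours_def insert_commute)
      have "z \<notin> L - {a}" using lobe_neighbours[OF L(1), of z] zH(2) mem(2)
        by (auto simp: neighbours_def)
      moreover have "z \<notin> L' - {a'}" using lobe_neighbours[OF L'(1), of z] zH(2) False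
        by (auto simp: neighbours_def)
      ultimately have "z \<in> free" using M_in zH edge_verts by (auto simp: free_def)
      then show ?thesis using free_edge_bridge b zH by blast
    qed
    have "3 \<le> card (neighbours H b)" using H_degree_free[OF b] d_ge by simp
    then obtain T where "T \<subseteq> neighbours H b" "card T = 3" by (meson obtain_subset_with_card_n)
    then obtain p q r where "{p, q, r} \<subseteq> neighbours H b" "p \<noteq> q" "p \<noteq> r" "q \<noteq> r"
      by (auto simp: card_3_iff)
    then show ?thesis using no_three_bridges_at_vertex[of b p q r] br by auto
  qed
  have "2 \<le> card (L - {a})" using tight(1) d_ge tL(1) by (simp add: Int_absorb2)
  then obtain T where "T \<subseteq> L - {a}" "card T = 2" by (meson obtain_subset_with_card_n)
  then obtain x1 x2 where x: "x1 \<in> L - {a}" "x2 \<in> L - {a}" "x1 \<noteq> x2" by (auto simp: card_2_iff)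
  \<comment> \<open>\<open>L\<close> is complete in \<open>H\<close>, so no edge of \<open>M\<close> runs inside it.\<close>
  have partner: "\<exists>y\<in>L' - {a'}. {x, y} \<in> M" if x: "x \<in> L - {a}" for x
  proof -
    obtain m where m: "m \<in> M" "x \<in> m" using x tL(1) by blast
    obtain p q where "m = {p, q}" using m M_subset edge_obtain by blast
    with m obtain y where y: "{x, y} \<in> M" by (auto simp: insert_commute)
    have "x \<noteq> y" using y M_subset edge_verts by blast
    have "y \<notin> L"
    proof
      assume "y \<in> L"
      then have "y \<in> neighbours H x" using tL(2)[OF x] \<open>x \<noteq> y\<close> by simp
      then show False using y by (simp add: neighbours_def)
    qed
    then show ?thesis using y M_in by auto
  qed
  obtain y1 where y1: "y1 \<in> L' - {a'}" "{x1, y1} \<in> M" using partner x(1) by blast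
  obtain y2 where y2: "y2 \<in> L' - {a'}" "{x2, y2} \<in> M" using partner x(2) by blast
  have "y1 \<noteq> y2"
  proof
    assume "y1 = y2"
    then have "{x1, y1} = {x2, y2}" using M_edges_meet[OF y1(2) y2(2), of y1] by auto
    with \<open>y1 = y2\<close> x(3) show False by (auto simp: doubleton_eq_iff)
  qed
  have nx: "x2 \<in> neighbours H x1" "a \<in> neighbours H x1" "a \<in> neighbours H x2"
    using tL(2)[OF x(1)] tL(2)[OF x(2)] x mem(1) by auto
  have ny: "y2 \<in> neighbours H y1" "a' \<in> neighbours H y1" "a' \<in> neighbours H y2"
    using tL'(2)[OF y1(1)] tL'(2)[OF y2(1)] y1(1) y2(1) \<open>y1 \<noteq> y2\<close> mem(5) by auto
  show False
    by (rule no_two_complete_lobes[OF x(3) y1(2) y2(2) a a'])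
      (use nx ny abH \<open>b = a'\<close> in \<open>auto simp: neighbours_def insert_commute\<close>)
qed

end

section \<open>Removable matchings of every size up to the bound\<close>

theorem theorem1p9:
  fixes V :: "'a set" and E :: "'a set set" and n :: nat
  assumes "simple_graph V E"
    and "connected_graph V E"
    and "card V = n"
    and "min_degree V E \<ge> 3"
  shows "\<exists>M. l_matching (min (n div 2) (min_degree V E)) E M \<and> one_removable V E M"
proof -
  interpret simple_graph V E by (rule assms(1))
  have deg: "min_degree V E \<le> degree E v" if "v \<in> V" for v
    using that finite_verts by (simp add: min_degree_def)
  have "\<exists>M. l_matching k E M \<and> one_removable V E M"
    if "k \<le> min (n div 2) (min_degree V E)" for k
    using that
  proof (induction k)
    case 0
    show ?case
      using assms(2) by (intro exI[of _ "{}"])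
        (simp add: l_matching_def matching_def one_removable_def)
  next
    case (Suc k)
    then obtain M where M: "matching E M" "card M = k" "connected_graph V (E - M)"
      by (auto simp: l_matching_def one_removable_def)
    show ?case
    proof (rule ccontr)
      assume none: "\<not> ?case"
      have "stuck_matching V E M (min_degree V E)"
      proof unfold_locales
        fix M' assume M': "matching E M'" "card M' = Suc (card M)"
        then have "l_matching (Suc k) E M'"
          using M(2) by (auto simp: l_matching_def intro: card_ge_0_finite)
        then show "\<not> connected_graph V (E - M')" using none by (auto simp: one_removable_def)
      qed (use M deg assms(3,4) Suc.prems in auto)
      then show False by (rule stuck_matching.stuck_impossible)
    qed
  qed
  then show ?thesis by blast
qed

end
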